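(* The axiomatization consisting of A1-4, WIF1, WIF2$'$ and W1$'$ is sound and ground-complete for BCCS($A$) modulo $\precsim_{\rm WF}$. If $A$ is infinite, it is also $\omega$-complete. If $A$ is finite, the axiomatization becomes $\omega$-complete by adding the axiom F2 (which is sound modulo $\precsim_{\rm WF}$).
   Context: $A$ is a nonempty countable set of actions, $\tau\notin A$, $A_\tau=A\cup\{\tau\}$. BCCS($A$) terms: $t::=0\mid x\mid\alpha t\mid t+t$ ($x$ from a countably infinite set of variables, $\alpha\in A_\tau$); closed terms have no variables. Transitions: $\alpha t\xrightarrow{\alpha}t$; if $t\xrightarrow{\alpha}t'$ then $t+u\xrightarrow{\alpha}t'$ and $u+t\xrightarrow{\alpha}t'$. $\Rightarrow$ is the reflexive-transitive closure of $\xrightarrow{\tau}$; $\mathcal{I}(s)=\{\alpha\in A_\tau\mid s\xrightarrow{\alpha}\}$. A pair $(a_1\cdots a_k,B)$, $a_i\in A$, $B\subseteq A$, is a weak failure pair of closed $s$ if $s\Rightarrow\xrightarrow{a_1}\Rightarrow\cdots\Rightarrow\xrightarrow{a_k}\Rightarrow s'$ with $\mathcal{I}(s')\subseteq A\setminus B$. $s_1\precsim_{\rm WF}s_2$ iff every weak failure pair of $s_1$ is one of $s_2$ and $s_1\xrightarrow{\tau}$ implies $s_2\xrightarrow{\tau}$; for open terms $t\precsim_{\rm WF}u$ iff $\rho(t)\precsim_{\rm WF}\rho(u)$ for all closed substitutions $\rho$. Inequational logic: reflexivity, transitivity, substitution instances, closure under prefix and $+$; an equation abbreviates two inequations. Sound: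 every derivable $t\preccurlyeq u$ satisfies $t\precsim_{\rm WF}u$. Ground-complete: closed $p\precsim_{\rm WF}q$ implies derivability of $p\preccurlyeq q$. $\omega$-complete: if $\rho(t)\preccurlyeq\rho(u)$ is derivable for all closed $\rho$ then $t\preccurlyeq u$ is derivable. Axioms (action symbols range over all actions): A1: $x+y\approx y+x$; A2: $(x+y)+z\approx x+(y+z)$; A3: $x+x\approx x$; A4: $x+0\approx x$; WIF1: $\alpha(\tau x+\tau y)\approx\alpha x+\alpha y$ ($\alpha\in A_\tau$); WIF2$'$: $\tau(x+y)\preccurlyeq\tau x+y$; W1$'$: $x\preccurlyeq\tau x+y$; F2: $\sum_{a\in A}ax_a\preccurlyeq\sum_{a\in A}ax_a+y$ with distinct variables $x_a$ ($a\in A$) and $y$. *)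

theory Defs
  imports Main "HOL-Library.Countable"
begin

text \<open>The action set $A$ is the universe of the type \<open>'a\<close> (nonempty as every HOL type; countability is
  imposed by the class \<open>countable\<close> in the theorem), $A_\tau$ is \<open>'a act\<close>, and the variables
  are the natural numbers.\<close>

datatype 'a act = Vis 'a | Tau

datatype 'a trm = Zero | Var nat | Pref "'a act" "'a trm" | Plus "'a trm" "'a trm"

fun vars :: "'a trm \<Rightarrow> nat set" where
  "vars Zero = {}"
| "vars (Var x) = {x}"
| "vars (Pref \<alpha> t) = vars t"
| "vars (Plus t u) = vars t \<union> vars u"

definition closed_trm :: "'a trm \<Rightarrow> bool" where
  "closed_trm t \<longleftrightarrow> vars t = {}"

fun subst :: "(nat \<Rightarrow> 'a trm) \<Rightarrow> 'a trm \<Rightarrow> 'a trm" where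
  "subst \<sigma> Zero = Zero"
| "subst \<sigma> (Var x) = \<sigma> x"
| "subst \<sigma> (Pref \<alpha> t) = Pref \<alpha> (subst \<sigma> t)"
| "subst \<sigma> (Plus t u) = Plus (subst \<sigma> t) (subst \<sigma> u)"

definition closed_subst :: "(nat \<Rightarrow> 'a trm) \<Rightarrow> bool" where
  "closed_subst \<rho> \<longleftrightarrow> (\<forall>x. closed_trm (\<rho> x))"

inductive step :: "'a trm \<Rightarrow> 'a act \<Rightarrow> 'a trm \<Rightarrow> bool" where
  step_pref: "step (Pref \<alpha> t) \<alpha> t"
| step_plus_left: "step t \<alpha> t' \<Longrightarrow> step (Plus t u) \<alpha> t'"
| step_plus_right: "step t \<alpha> t' \<Longrightarrow> step (Plus u t) \<alpha> t'"

definition tau_steps :: "'a trm \<Rightarrow> 'a trm \<Rightarrow> bool" where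
  "tau_steps = (\<lambda>s s'. step s Tau s')\<^sup>*\<^sup>*"

definition initials :: "'a trm \<Rightarrow> 'a act set" where
  "initials s = {\<alpha>. \<exists>s'. step s \<alpha> s'}"

fun weak_trace :: "'a trm \<Rightarrow> 'a list \<Rightarrow> 'a trm \<Rightarrow> bool" where
  "weak_trace s [] s' \<longleftrightarrow> tau_steps s s'"
| "weak_trace s (a # w) s' \<longleftrightarrow>
     (\<exists>s1 s2. tau_steps s s1 \<and> step s1 (Vis a) s2 \<and> weak_trace s2 w s')"

definition weak_failure_pair :: "'a trm \<Rightarrow> 'a list \<Rightarrow> 'a set \<Rightarrow> bool" where
  "weak_failure_pair s w B \<longleftrightarrow> (\<exists>s'. weak_trace s w s' \<and> initials s' \<subseteq> Vis ` (UNIV - B))"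

text \<open>The preorder \<open>closed_WF_le\<close> is meant for closed terms only; \<open>WF_le\<close> lifts it to open terms.\<close>

definition closed_WF_le :: "'a trm \<Rightarrow> 'a trm \<Rightarrow> bool" where
  "closed_WF_le s1 s2 \<longleftrightarrow>
     (\<forall>w B. weak_failure_pair s1 w B \<longrightarrow> weak_failure_pair s2 w B) \<and>
     (Tau \<in> initials s1 \<longrightarrow> Tau \<in> initials s2)"

definition WF_le :: "'a trm \<Rightarrow> 'a trm \<Rightarrow> bool" where
  "WF_le t u \<longleftrightarrow> (\<forall>\<rho>. closed_subst \<rho> \<longrightarrow> closed_WF_le (subst \<rho> t) (subst \<rho> u))"

text \<open>A pair \<open>(t, u)\<close> in an axiom set stands for the inequation $t \preccurlyeq u$.\<close>

inductive derivable :: "('a trm \<times> 'a trm) set \<Rightarrow> 'a trm \<Rightarrow> 'a trm \<Rightarrow> bool"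
  for E :: "('a trm \<times> 'a trm) set" where
  derivable_ax: "(t, u) \<in> E \<Longrightarrow> derivable E (subst \<sigma> t) (subst \<sigma> u)"
| derivable_refl: "derivable E t t"
| derivable_trans: "derivable E t u \<Longrightarrow> derivable E u v \<Longrightarrow> derivable E t v"
| derivable_pref: "derivable E t u \<Longrightarrow> derivable E (Pref \<alpha> t) (Pref \<alpha> u)"
| derivable_plus: "derivable E t u \<Longrightarrow> derivable E t' u' \<Longrightarrow> derivable E (Plus t t') (Plus u u')"

lemma subst_subst: "subst \<sigma> (subst \<sigma>' t) = subst (\<lambda>x. subst \<sigma> (\<sigma>' x)) t"
  by (induction t) auto

lemma derivable_subst: "derivable E t u \<Longrightarrow> derivable E (subst \<sigma> t) (subst \<sigma> u)"
  by (induction rule: derivable.induct) (auto simp: subst_subst intro: derivable.intros)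

definition sound :: "('a trm \<times> 'a trm) set \<Rightarrow> bool" where
  "sound E \<longleftrightarrow> (\<forall>t u. derivable E t u \<longrightarrow> WF_le t u)"

definition ground_complete :: "('a trm \<times> 'a trm) set \<Rightarrow> bool" where
  "ground_complete E \<longleftrightarrow>
     (\<forall>p q. closed_trm p \<longrightarrow> closed_trm q \<longrightarrow> closed_WF_le p q \<longrightarrow> derivable E p q)"

definition omega_complete :: "('a trm \<times> 'a trm) set \<Rightarrow> bool" where
  "omega_complete E \<longleftrightarrow>
     (\<forall>t u. (\<forall>\<rho>. closed_subst \<rho> \<longrightarrow> derivable E (subst \<rho> t) (subst \<rho> u)) \<longrightarrow> derivable E t u)"

definition equation :: "'a trm \<Rightarrow> 'a trm \<Rightarrow> ('a trm \<times> 'a trm) set" where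
  "equation t u = {(t, u), (u, t)}"

abbreviation "X \<equiv> Var 0"
abbreviation "Y \<equiv> Var 1"
abbreviation "Z \<equiv> Var 2"

definition A1 :: "('a trm \<times> 'a trm) set" where
  "A1 = equation (Plus X Y) (Plus Y X)"

definition A2 :: "('a trm \<times> 'a trm) set" where
  "A2 = equation (Plus (Plus X Y) Z) (Plus X (Plus Y Z))"

definition A3 :: "('a trm \<times> 'a trm) set" where
  "A3 = equation (Plus X X) X"

definition A4 :: "('a trm \<times> 'a trm) set" where
  "A4 = equation (Plus X Zero) X"

definition WIF1 :: "('a trm \<times> 'a trm) set" where
  "WIF1 = (\<Union>\<alpha>. equation (Pref \<alpha> (Plus (Pref Tau X) (Pref Tau Y)))
                         (Plus (Pref \<alpha> X) (Pref \<alpha> Y)))"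

definition WIF2' :: "('a trm \<times> 'a trm) set" where
  "WIF2' = {(Pref Tau (Plus X Y), Plus (Pref Tau X) Y)}"

definition W1' :: "('a trm \<times> 'a trm) set" where
  "W1' = {(X, Plus (Pref Tau X) Y)}"

definition WF_axioms :: "('a trm \<times> 'a trm) set" where
  "WF_axioms = A1 \<union> A2 \<union> A3 \<union> A4 \<union> WIF1 \<union> WIF2' \<union> W1'"

fun sum_trm :: "'a trm list \<Rightarrow> 'a trm" where
  "sum_trm [] = Zero"
| "sum_trm [t] = t"
| "sum_trm (t # u # ts) = Plus t (sum_trm (u # ts))"

text \<open>The finite sum over $A$ in F2 is taken along a list \<open>as\<close> enumerating $A$ without repetition;
  the variable $x_a$ is \<open>Var (xv a)\<close> and $y$ is \<open>Var y\<close>.  The choice of enumeration and of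
  pairwise distinct variables is left open here, and the theorem covers every choice.\<close>

definition F2_choice :: "'a list \<Rightarrow> ('a \<Rightarrow> nat) \<Rightarrow> nat \<Rightarrow> bool" where
  "F2_choice as xv y \<longleftrightarrow> distinct as \<and> set as = UNIV \<and> inj xv \<and> y \<notin> range xv"

definition F2_lhs :: "'a list \<Rightarrow> ('a \<Rightarrow> nat) \<Rightarrow> 'a trm" where
  "F2_lhs as xv = sum_trm (map (\<lambda>a. Pref (Vis a) (Var (xv a))) as)"

definition F2_rhs :: "'a list \<Rightarrow> ('a \<Rightarrow> nat) \<Rightarrow> nat \<Rightarrow> 'a trm" where
  "F2_rhs as xv y = Plus (F2_lhs as xv) (Var y)"

lemma F2_choice_exists:
  assumes "finite (UNIV :: 'a :: countable set)"
  shows "\<exists>(as :: 'a list) xv y. F2_choice as xv y"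
proof -
  obtain as :: "'a list" where "set as = UNIV" "distinct as"
    using finite_distinct_list[OF assms] by blast
  moreover have "inj (\<lambda>a :: 'a. Suc (to_nat a))" by (simp add: inj_on_def)
  moreover have "0 \<notin> range (\<lambda>a :: 'a. Suc (to_nat a))" by auto
  ultimately show ?thesis unfolding F2_choice_def by blast
qed

end

theory Submission imports Defs begin

text \<open>
  Treat the variables of an open term as additional inert actions. A closed substitution mapping
  variables to \<open>0\<close> or to long sequences \<open>b\<^sup>n\<close> turns \<open>t \<lesssim> u\<close> into a condition on the transitions
  of \<open>t\<close> and \<open>u\<close> themselves: weak traces, and weak traces ending in a variable, are preserved, and
  a stable derivative of \<open>t\<close> is matched by a derivative of \<open>u\<close> having no more initial actions and
  no more variables. The last part needs an action \<open>b\<close> that the derivative of \<open>t\<close> refuses, so it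
  can fail when all of \<open>A\<close> is enabled, which is where F2 is used.

  The condition implies derivability by induction on \<open>t\<close>. The axioms let \<open>u\<close> absorb every summand
  of a term reachable from \<open>u\<close> by \<open>\<tau>\<close>-steps, and, when \<open>u\<close> has a \<open>\<tau>\<close>-summand, give \<open>u \<preceq> u + y\<close>.
  By WIF1 all weak \<open>a\<close>-derivatives of \<open>u\<close> merge into a single summand \<open>a u\<^sub>a\<close>.
  If \<open>t\<close> is stable, then \<open>t \<preceq> r\<close>, where \<open>r\<close> replaces each summand \<open>a t'\<close> of \<open>t\<close> by \<open>a u\<^sub>a\<close>;
  \<open>u\<close> absorbs \<open>r\<close>, and \<open>r\<close> absorbs the derivative \<open>v\<close> of \<open>u\<close> matching \<open>t\<close>, so that
  \<open>r \<preceq> v + r \<preceq> \<tau>(v + r) + u \<preceq> \<tau>v + r + u \<preceq> u\<close>.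
\<close>

section \<open>Transitions and weak failure pairs\<close>

text \<open>Modulo A1-A4 a term is determined by this set, which lets rearrangements of sums be
  settled by comparing sets.\<close>

fun summands :: "'a trm \<Rightarrow> 'a trm set" where
  "summands Zero = {}"
| "summands (Var x) = {Var x}"
| "summands (Pref \<alpha> t) = {Pref \<alpha> t}"
| "summands (Plus t u) = summands t \<union> summands u"

lemma summands_summand: "s \<in> summands t \<Longrightarrow> summands s = {s}"
  by (induction t) auto

inductive_cases step_ZeroE [elim!]: "step Zero \<alpha> t"
inductive_cases step_VarE [elim!]: "step (Var x) \<alpha> t"
inductive_cases step_PrefE: "step (Pref \<beta> t) \<alpha> t'"
inductive_cases step_PlusE: "step (Plus t u) \<alpha> t'"

lemma step_Zero [simp]: "\<not> step Zero \<alpha> t"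
  by blast

lemma step_Var [simp]: "\<not> step (Var x) \<alpha> t"
  by blast

lemma step_Pref [simp]: "step (Pref \<beta> t) \<alpha> t' \<longleftrightarrow> \<alpha> = \<beta> \<and> t' = t"
  by (auto elim: step_PrefE intro: step.intros)

lemma step_Plus [simp]: "step (Plus t u) \<alpha> t' \<longleftrightarrow> step t \<alpha> t' \<or> step u \<alpha> t'"
  by (auto elim: step_PlusE intro: step.intros)

lemma step_iff_summands: "step t \<alpha> t' \<longleftrightarrow> Pref \<alpha> t' \<in> summands t"
  by (induction t) auto

lemma step_size: "step t \<alpha> t' \<Longrightarrow> size t' < size t"
  by (induction t) auto

lemma initials_simps [simp]:
  "initials Zero = {}"
  "initials (Var x) = {}"
  "initials (Pref \<alpha> t) = {\<alpha>}"
  "initials (Plus t u) = initials t \<union> initials u"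
  by (auto simp: initials_def)

text \<open>Interleaves tau-steps and visible steps in a single induction, in place of the nested
  closures of \<open>weak_trace\<close>.\<close>

inductive wtrace :: "'a trm \<Rightarrow> 'a list \<Rightarrow> 'a trm \<Rightarrow> bool" where
  wtrace_refl: "wtrace s [] s"
| wtrace_tau: "step s Tau s1 \<Longrightarrow> wtrace s1 w s' \<Longrightarrow> wtrace s w s'"
| wtrace_vis: "step s (Vis a) s1 \<Longrightarrow> wtrace s1 w s' \<Longrightarrow> wtrace s (a # w) s'"

lemma tau_steps_wtrace: "tau_steps s s1 \<Longrightarrow> wtrace s1 w s' \<Longrightarrow> wtrace s w s'"
  unfolding tau_steps_def by (induction rule: converse_rtranclp_induct) (auto intro: wtrace_tau)

lemma weak_trace_iff_wtrace: "weak_trace s w s' \<longleftrightarrow> wtrace s w s'"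
proof
  show "weak_trace s w s' \<Longrightarrow> wtrace s w s'"
    by (induction w arbitrary: s) (auto intro: tau_steps_wtrace wtrace_refl wtrace_vis)
  show "wtrace s w s' \<Longrightarrow> weak_trace s w s'"
  proof (induction rule: wtrace.induct)
    case (wtrace_tau s s1 w s')
    then show ?case
      by (cases w) (auto simp: tau_steps_def intro: converse_rtranclp_into_rtranclp)
  qed (auto simp: tau_steps_def)
qed

lemma weak_failure_pair_wtrace:
  "weak_failure_pair s w B \<longleftrightarrow> (\<exists>s'. wtrace s w s' \<and> initials s' \<subseteq> Vis ` (UNIV - B))"
  by (simp add: weak_failure_pair_def weak_trace_iff_wtrace)

lemma wtrace_append: "wtrace s w s1 \<Longrightarrow> wtrace s1 w' s' \<Longrightarrow> wtrace s (w @ w') s'"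
  by (induction rule: wtrace.induct) (auto intro: wtrace.intros)

lemma wtrace_unfold:
  "wtrace s w s' \<longleftrightarrow> w = [] \<and> s' = s \<or> (\<exists>s1. step s Tau s1 \<and> wtrace s1 w s')
     \<or> (\<exists>a v s1. w = a # v \<and> step s (Vis a) s1 \<and> wtrace s1 v s')"
  by (subst wtrace.simps) auto

lemma wtrace_Cons:
  "wtrace s (a # w) s' \<longleftrightarrow> (\<exists>s1 s2. wtrace s [] s1 \<and> step s1 (Vis a) s2 \<and> wtrace s2 w s')"
  by (simp flip: weak_trace_iff_wtrace)

lemma wtrace_length: "wtrace s w s' \<Longrightarrow> length w + size s' \<le> size s"
  by (induction rule: wtrace.induct) (auto dest: step_size)

text \<open>Steps shrink terms, so every sequence of tau-steps ends.\<close>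

lemma stable_derivative_exists: "\<exists>s'. wtrace s [] s' \<and> Tau \<notin> initials s'"
proof (induction "size s" arbitrary: s rule: less_induct)
  case less
  show ?case
  proof (cases "Tau \<in> initials s")
    case True
    then obtain s1 where s1: "step s Tau s1" by (auto simp: initials_def)
    with less[of s1] show ?thesis by (meson step_size wtrace_tau)
  qed (auto intro: wtrace_refl)
qed

lemma stable_initials: "Tau \<notin> I \<Longrightarrow> I \<subseteq> range Vis"
proof
  show "\<alpha> \<in> range Vis" if "Tau \<notin> I" "\<alpha> \<in> I" for \<alpha>
    using that by (cases \<alpha>) auto
qed

text \<open>A weak trace can always be prolonged by tau-steps to a stable term, and stable terms
  refuse the empty set. Hence weak failure pairs determine the weak traces.\<close>

lemma weak_failure_pair_empty: "(\<exists>s'. wtrace s w s') \<longleftrightarrow> weak_failure_pair s w {}"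
proof
  assume "\<exists>s'. wtrace s w s'"
  then obtain s' s'' where "wtrace s w s'" "wtrace s' [] s''" "Tau \<notin> initials s''"
    using stable_derivative_exists by blast
  then have "wtrace s w s''" "initials s'' \<subseteq> range Vis"
    using wtrace_append[of s w s' "[]" s''] stable_initials by auto
  then show "weak_failure_pair s w {}"
    by (auto simp: weak_failure_pair_wtrace)
qed (auto simp: weak_failure_pair_wtrace)

lemma weak_failure_pair_unfold:
  "weak_failure_pair s w B \<longleftrightarrow> w = [] \<and> initials s \<subseteq> Vis ` (UNIV - B)
     \<or> (\<exists>s1. step s Tau s1 \<and> weak_failure_pair s1 w B)
     \<or> (\<exists>a v s1. w = a # v \<and> step s (Vis a) s1 \<and> weak_failure_pair s1 v B)"
  unfolding weak_failure_pair_wtrace by (subst wtrace_unfold) blast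

lemma unstable_weak_failure_pair:
  "Tau \<in> initials s \<and> weak_failure_pair s [] B \<longleftrightarrow>
     (\<exists>s1. step s Tau s1 \<and> weak_failure_pair s1 [] B)"
  by (subst weak_failure_pair_unfold) (auto simp: initials_def)

lemma stable_weak_failure_pair:
  "Tau \<notin> initials s \<Longrightarrow> weak_failure_pair s [] B \<longleftrightarrow> initials s \<subseteq> Vis ` (UNIV - B)"
  by (subst weak_failure_pair_unfold) (auto simp: initials_def)

lemma weak_failure_pair_Zero [simp]: "weak_failure_pair Zero w B \<longleftrightarrow> w = []"
  by (subst weak_failure_pair_unfold) auto

lemma weak_failure_pair_Tau [simp]: "weak_failure_pair (Pref Tau t) w B \<longleftrightarrow> weak_failure_pair t w B"
  by (subst weak_failure_pair_unfold) auto

lemma weak_failure_pair_Vis [simp]: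
  "weak_failure_pair (Pref (Vis a) t) [] B \<longleftrightarrow> a \<notin> B"
  "weak_failure_pair (Pref (Vis a) t) (c # w) B \<longleftrightarrow> c = a \<and> weak_failure_pair t w B"
  by (subst weak_failure_pair_unfold; auto)+

lemma weak_failure_pair_Plus_Cons [simp]:
  "weak_failure_pair (Plus s t) (a # w) B \<longleftrightarrow>
     weak_failure_pair s (a # w) B \<or> weak_failure_pair t (a # w) B"
  unfolding weak_failure_pair_unfold[of "Plus s t"] weak_failure_pair_unfold[of s]
    weak_failure_pair_unfold[of t]
  by auto

text \<open>If a summand is unstable, so is the sum, and the pair must come from a tau-step of an
  unstable summand. Otherwise the sum itself must refuse \<open>B\<close>, which requires both
  summands to do so.\<close>

lemma weak_failure_pair_Plus_Nil [simp]:
  "weak_failure_pair (Plus s t) [] B \<longleftrightarrow>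
     (if Tau \<in> initials s \<or> Tau \<in> initials t
      then Tau \<in> initials s \<and> weak_failure_pair s [] B \<or> Tau \<in> initials t \<and> weak_failure_pair t [] B
      else weak_failure_pair s [] B \<and> weak_failure_pair t [] B)"
proof (cases "Tau \<in> initials s \<or> Tau \<in> initials t")
  case True
  then have "weak_failure_pair (Plus s t) [] B \<longleftrightarrow>
      (\<exists>s1. step (Plus s t) Tau s1 \<and> weak_failure_pair s1 [] B)"
    using unstable_weak_failure_pair[of "Plus s t" B] by simp
  also have "\<dots> \<longleftrightarrow> (\<exists>s1. step s Tau s1 \<and> weak_failure_pair s1 [] B) \<or>
      (\<exists>s1. step t Tau s1 \<and> weak_failure_pair s1 [] B)"
    by auto
  finally show ?thesis
    using True by (simp flip: unstable_weak_failure_pair)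
qed (simp add: stable_weak_failure_pair)

section \<open>Soundness\<close>

lemma closed_WF_le_Pref:
  assumes "closed_WF_le s t"
  shows "closed_WF_le (Pref \<alpha> s) (Pref \<alpha> t)"
proof -
  have "weak_failure_pair (Pref \<alpha> t) w B" if "weak_failure_pair (Pref \<alpha> s) w B" for w B
    using that assms by (cases \<alpha>; cases w) (auto simp: closed_WF_le_def)
  then show ?thesis by (simp add: closed_WF_le_def)
qed

text \<open>For the empty trace the clause on tau is essential: an unstable summand on the left is
  matched by an unstable summand on the right, whose pairs survive in the sum.\<close>

lemma closed_WF_le_Plus:
  assumes "closed_WF_le s t" "closed_WF_le s' t'"
  shows "closed_WF_le (Plus s s') (Plus t t')"
proof -
  have "weak_failure_pair (Plus t t') w B" if h: "weak_failure_pair (Plus s s') w B" for w B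
  proof (cases w)
    case Nil
    show ?thesis using h assms unfolding Nil closed_WF_le_def
      by (auto split: if_splits)
  qed (use h assms in \<open>auto simp: closed_WF_le_def\<close>)
  then show ?thesis using assms by (auto simp: closed_WF_le_def)
qed

text \<open>\<open>closed_WF_le\<close> is used here on open terms too, where variables are inert
  like \<open>Zero\<close>. It is a precongruence on all terms, so only the axioms have to be
  checked.\<close>

lemma sound_if_axioms_sound:
  assumes ax: "\<And>t u \<sigma>. (t, u) \<in> E \<Longrightarrow> closed_WF_le (subst \<sigma> t) (subst \<sigma> u)"
  shows "sound E"
proof -
  have "closed_WF_le t u" if "derivable E t u" for t u
    using that
  proof (induction rule: derivable.induct)
    case (derivable_trans t u v)
    then show ?case by (auto simp: closed_WF_le_def)
  qed (auto intro: ax closed_WF_le_Pref closed_WF_le_Plus simp: closed_WF_le_def[of t t for t])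
  then show ?thesis
    by (auto simp: sound_def WF_le_def intro: derivable_subst)
qed

lemma closed_WF_leI:
  assumes "\<And>B. weak_failure_pair s [] B \<Longrightarrow> weak_failure_pair t [] B"
    and "\<And>a w B. weak_failure_pair s (a # w) B \<Longrightarrow> weak_failure_pair t (a # w) B"
    and "Tau \<in> initials s \<Longrightarrow> Tau \<in> initials t"
  shows "closed_WF_le s t"
proof -
  have "weak_failure_pair t w B" if "weak_failure_pair s w B" for w B
    using that assms(1,2) by (cases w) simp_all
  then show ?thesis using assms(3) by (simp add: closed_WF_le_def)
qed

lemma closed_WF_le_WIF1:
  "closed_WF_le (Pref \<alpha> (Plus (Pref Tau s) (Pref Tau t))) (Plus (Pref \<alpha> s) (Pref \<alpha> t))"
  "closed_WF_le (Plus (Pref \<alpha> s) (Pref \<alpha> t)) (Pref \<alpha> (Plus (Pref Tau s) (Pref Tau t)))"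
proof -
  have eq: "weak_failure_pair (Plus (Pref Tau s) (Pref Tau t)) w B \<longleftrightarrow>
      weak_failure_pair s w B \<or> weak_failure_pair t w B" for w B
    by (cases w) auto
  show "closed_WF_le (Pref \<alpha> (Plus (Pref Tau s) (Pref Tau t))) (Plus (Pref \<alpha> s) (Pref \<alpha> t))"
    by (cases \<alpha>; rule closed_WF_leI) (auto simp: eq)
  show "closed_WF_le (Plus (Pref \<alpha> s) (Pref \<alpha> t)) (Pref \<alpha> (Plus (Pref Tau s) (Pref Tau t)))"
    by (cases \<alpha>; rule closed_WF_leI) (auto simp: eq)
qed

lemma closed_WF_le_axioms:
  "closed_WF_le (Plus p q) (Plus q p)"
  "closed_WF_le (Plus (Plus p q) r) (Plus p (Plus q r))"
  "closed_WF_le (Plus p (Plus q r)) (Plus (Plus p q) r)"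
  "closed_WF_le (Plus p p) p"
  "closed_WF_le p (Plus p p)"
  "closed_WF_le (Plus p Zero) p"
  "closed_WF_le p (Plus p Zero)"
  "closed_WF_le (Pref Tau (Plus p q)) (Plus (Pref Tau p) q)"
  "closed_WF_le p (Plus (Pref Tau p) q)"
  by (rule closed_WF_leI; auto split: if_splits)+

lemma WF_axioms_closed_WF_le:
  assumes "(t, u) \<in> WF_axioms"
  shows "closed_WF_le (subst \<sigma> t) (subst \<sigma> u)"
  using assms
  by (auto simp: WF_axioms_def A1_def A2_def A3_def A4_def WIF1_def WIF2'_def W1'_def equation_def
      intro: closed_WF_le_axioms closed_WF_le_WIF1)

lemma initials_sum_trm: "initials (sum_trm ts) = (\<Union>t\<in>set ts. initials t)"
  by (induction ts rule: sum_trm.induct) auto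

lemma subst_sum_trm: "subst \<sigma> (sum_trm ts) = sum_trm (map (subst \<sigma>) ts)"
  by (induction ts rule: sum_trm.induct) auto

lemma subst_F2_lhs:
  "subst \<sigma> (F2_lhs as xv) = sum_trm (map (\<lambda>a. Pref (Vis a) (\<sigma> (xv a))) as)"
  by (simp add: F2_lhs_def subst_sum_trm comp_def)

text \<open>The left-hand side is stable and enables every action, so after the empty trace it
  refuses only the empty set, as every term does. Longer traces survive adding a summand.\<close>

lemma F2_closed_WF_le:
  assumes "F2_choice as xv y"
  shows "closed_WF_le (subst \<sigma> (F2_lhs as xv)) (subst \<sigma> (F2_rhs as xv y))"
proof -
  let ?l = "subst \<sigma> (F2_lhs as xv)"
  have I: "initials ?l = range Vis"
    using assms by (auto simp: subst_F2_lhs initials_sum_trm F2_choice_def)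
  then have stable: "Tau \<notin> initials ?l" by auto
  have "weak_failure_pair (Plus ?l (\<sigma> y)) [] B" if "weak_failure_pair ?l [] B" for B
  proof -
    have "B = {}"
      using that I stable by (auto simp: stable_weak_failure_pair)
    moreover have "weak_failure_pair (Plus ?l (\<sigma> y)) [] {}"
      using wtrace_refl weak_failure_pair_empty by blast
    ultimately show ?thesis by simp
  qed
  then show ?thesis
    using stable by (intro closed_WF_leI) (auto simp: F2_rhs_def)
qed

section \<open>Derived laws\<close>

declare derivable_trans [trans]

text \<open>Leaving \<open>E\<close> open above the basic axioms makes the derived laws available
  both with and without F2.\<close>

locale WF_theory =
  fixes E :: "('a trm \<times> 'a trm) set"
  assumes axioms: "WF_axioms \<subseteq> E"
begin

abbreviation le :: "'a trm \<Rightarrow> 'a trm \<Rightarrow> bool" (infix "\<preceq>" 50) where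
  "t \<preceq> u \<equiv> derivable E t u"

lemma axiom_instance:
  assumes "(t, u) \<in> WF_axioms"
  shows "subst (\<lambda>i. if i = 0 then p else if i = 1 then q else r) t
    \<preceq> subst (\<lambda>i. if i = 0 then p else if i = 1 then q else r) u"
  using assms axioms by (blast intro: derivable_ax)

lemma axiom_instances:
  shows plus_comm: "Plus p q \<preceq> Plus q p"
    and plus_assoc: "Plus (Plus p q) r \<preceq> Plus p (Plus q r)"
    and plus_assoc': "Plus p (Plus q r) \<preceq> Plus (Plus p q) r"
    and plus_idem: "Plus p p \<preceq> p"
    and plus_idem': "p \<preceq> Plus p p"
    and plus_Zero: "Plus p Zero \<preceq> p"
    and plus_Zero': "p \<preceq> Plus p Zero"
    and unmerge: "Pref \<alpha> (Plus (Pref Tau p) (Pref Tau q)) \<preceq> Plus (Pref \<alpha> p) (Pref \<alpha> q)"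
    and tau_plus: "Pref Tau (Plus p q) \<preceq> Plus (Pref Tau p) q"
    and le_tau_plus: "p \<preceq> Plus (Pref Tau p) q"
  using axiom_instance[of "Plus X Y" "Plus Y X" p q r]
    axiom_instance[of "Plus (Plus X Y) Z" "Plus X (Plus Y Z)" p q r]
    axiom_instance[of "Plus X (Plus Y Z)" "Plus (Plus X Y) Z" p q r]
    axiom_instance[of "Plus X X" X p q r]
    axiom_instance[of X "Plus X X" p q r]
    axiom_instance[of "Plus X Zero" X p q r]
    axiom_instance[of X "Plus X Zero" p q r]
    axiom_instance[of "Pref \<alpha> (Plus (Pref Tau X) (Pref Tau Y))" "Plus (Pref \<alpha> X) (Pref \<alpha> Y)" p q r]
    axiom_instance[of "Pref Tau (Plus X Y)" "Plus (Pref Tau X) Y" p q r]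
    axiom_instance[of X "Plus (Pref Tau X) Y" p q r]
  by (simp_all add: WF_axioms_def A1_def A2_def A3_def A4_def WIF1_def WIF2'_def W1'_def equation_def)

lemma plus_mono_right: "p \<preceq> q \<Longrightarrow> Plus r p \<preceq> Plus r q"
  by (blast intro: derivable_plus derivable_refl)

lemma plus_mono_left: "p \<preceq> q \<Longrightarrow> Plus p r \<preceq> Plus q r"
  by (blast intro: derivable_plus derivable_refl)

lemma absorb_summands:
  assumes "\<And>s. s \<in> summands t \<Longrightarrow> Plus u s \<preceq> u"
  shows "Plus u t \<preceq> u"
  using assms
proof (induction t)
  case Zero
  show ?case by (rule plus_Zero)
next
  case (Plus t1 t2)
  have "Plus u (Plus t1 t2) \<preceq> Plus (Plus u t1) t2" by (rule plus_assoc')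
  also have "\<dots> \<preceq> Plus u t2" using Plus by (intro plus_mono_left) simp
  also have "\<dots> \<preceq> u" using Plus by simp
  finally show ?case .
qed simp_all

lemma add_summands:
  assumes "\<And>s. s \<in> summands t \<Longrightarrow> u \<preceq> Plus u s"
  shows "u \<preceq> Plus u t"
  using assms
proof (induction t)
  case Zero
  show ?case by (rule plus_Zero')
next
  case (Plus t1 t2)
  have "u \<preceq> Plus u t2" using Plus by simp
  also have "\<dots> \<preceq> Plus (Plus u t1) t2" using Plus by (intro plus_mono_left) simp
  also have "\<dots> \<preceq> Plus u (Plus t1 t2)" by (rule plus_assoc)
  finally show ?case .
qed simp_all

lemma summand_idem:
  assumes "s \<in> summands u"
  shows "Plus u s \<preceq> u \<and> u \<preceq> Plus u s"
  using assms
proof (induction u)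
  case (Plus u1 u2)
  have right: "Plus (Plus u1 u2) s \<preceq> Plus u1 (Plus u2 s)"
    "Plus u1 (Plus u2 s) \<preceq> Plus (Plus u1 u2) s"
    by (rule plus_assoc plus_assoc')+
  have "Plus (Plus u1 u2) s \<preceq> Plus (Plus u2 u1) s" by (intro plus_mono_left plus_comm)
  also have "\<dots> \<preceq> Plus u2 (Plus u1 s)" by (rule plus_assoc)
  also have "\<dots> \<preceq> Plus (Plus u1 s) u2" by (rule plus_comm)
  finally have left: "Plus (Plus u1 u2) s \<preceq> Plus (Plus u1 s) u2" .
  have "Plus (Plus u1 s) u2 \<preceq> Plus u2 (Plus u1 s)" by (rule plus_comm)
  also have "\<dots> \<preceq> Plus (Plus u2 u1) s" by (rule plus_assoc')
  also have "\<dots> \<preceq> Plus (Plus u1 u2) s" by (intro plus_mono_left plus_comm)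
  finally have left': "Plus (Plus u1 s) u2 \<preceq> Plus (Plus u1 u2) s" .
  consider "s \<in> summands u1" | "s \<in> summands u2" using Plus.prems by auto
  then show ?case
  proof cases
    case 1
    then show ?thesis
      using Plus.IH(1) derivable_trans[OF left plus_mono_left] derivable_trans[OF plus_mono_left left']
      by blast
  next
    case 2
    then show ?thesis
      using Plus.IH(2) derivable_trans[OF right(1) plus_mono_right]
        derivable_trans[OF plus_mono_right right(2)]
      by blast
  qed
qed (auto intro: plus_idem plus_idem')

text \<open>Add the summands of \<open>u\<close> to \<open>t\<close>, commute, then absorb those of
  \<open>t\<close> into \<open>u\<close>; both directions of idempotence are used.\<close>

lemma le_if_summands_eq:
  assumes "summands t = summands u"
  shows "t \<preceq> u"
proof -
  have "t \<preceq> Plus t u" by (rule add_summands) (simp add: assms summand_idem)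
  also have "\<dots> \<preceq> Plus u t" by (rule plus_comm)
  also have "\<dots> \<preceq> u" by (rule absorb_summands) (simp add: assms summand_idem)
  finally show ?thesis .
qed

lemma le_tau: "p \<preceq> Pref Tau p"
  by (rule derivable_trans[OF le_tau_plus plus_Zero])

lemma pref_tau: "Pref \<alpha> (Pref Tau p) \<preceq> Pref \<alpha> p"
proof -
  have "Pref \<alpha> (Pref Tau p) \<preceq> Pref \<alpha> (Plus (Pref Tau p) (Pref Tau p))"
    by (intro derivable_pref plus_idem')
  also have "\<dots> \<preceq> Plus (Pref \<alpha> p) (Pref \<alpha> p)" by (rule unmerge)
  also have "\<dots> \<preceq> Pref \<alpha> p" by (rule plus_idem)
  finally show ?thesis .
qed

lemma unstable_summand:
  assumes "Tau \<in> initials u"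
  obtains u0 where "u \<preceq> Plus (Pref Tau u0) u" "Plus (Pref Tau u0) u \<preceq> u"
proof -
  obtain u0 where "Pref Tau u0 \<in> summands u"
    using assms by (auto simp: initials_def step_iff_summands)
  then have "u \<preceq> Plus (Pref Tau u0) u" "Plus (Pref Tau u0) u \<preceq> u"
    by (auto intro!: le_if_summands_eq)
  then show ?thesis by (rule that)
qed

text \<open>W1' is applied to a summand \<open>Pref Tau u0\<close> in the role of x; the doubled tau
  then collapses by \<open>pref_tau\<close>.\<close>

lemma unstable_le_plus:
  assumes "Tau \<in> initials u"
  shows "u \<preceq> Plus u y"
proof -
  obtain u0 where u0: "u \<preceq> Plus (Pref Tau u0) u" "Plus (Pref Tau u0) u \<preceq> u"
    using assms by (rule unstable_summand)
  have "Pref Tau u0 \<preceq> Plus (Pref Tau (Pref Tau u0)) y" by (rule le_tau_plus)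
  also have "\<dots> \<preceq> Plus (Pref Tau u0) y" by (intro plus_mono_left pref_tau)
  finally have "Plus (Pref Tau u0) u \<preceq> Plus (Plus (Pref Tau u0) y) u" by (rule plus_mono_left)
  with u0(1) have "u \<preceq> Plus (Plus (Pref Tau u0) y) u" by (rule derivable_trans)
  also have "\<dots> \<preceq> Plus (Plus (Pref Tau u0) u) y" by (rule le_if_summands_eq) auto
  also have "\<dots> \<preceq> Plus u y" using u0 by (intro plus_mono_left)
  finally show ?thesis .
qed

text \<open>WIF2' moves the outer tau onto a summand that already begins with tau, where
  \<open>pref_tau\<close> removes it.\<close>

lemma tau_unstable_le:
  assumes "Tau \<in> initials u"
  shows "Pref Tau u \<preceq> u"
proof -
  obtain u0 where u0: "u \<preceq> Plus (Pref Tau u0) u" "Plus (Pref Tau u0) u \<preceq> u"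
    using assms by (rule unstable_summand)
  have "Pref Tau u \<preceq> Pref Tau (Plus (Pref Tau u0) u)" using u0 by (intro derivable_pref)
  also have "\<dots> \<preceq> Plus (Pref Tau (Pref Tau u0)) u" by (rule tau_plus)
  also have "\<dots> \<preceq> Plus (Pref Tau u0) u" by (intro plus_mono_left pref_tau)
  also have "\<dots> \<preceq> u" by (rule u0)
  finally show ?thesis .
qed

text \<open>A term with a tau-step to \<open>s1\<close> absorbs \<open>s1\<close>, because
  \<open>s1\<close> lies below \<open>Pref Tau s1\<close>; by induction \<open>s1\<close> absorbs
  the rest. The premise \<open>w = []\<close> is kept separate to allow rule induction.\<close>

lemma absorb_tau_derivative:
  assumes "wtrace u w v" "w = []"
  shows "Plus u v \<preceq> u \<and> u \<preceq> Plus u v"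
  using assms
proof (induction rule: wtrace.induct)
  case (wtrace_refl s)
  show ?case using plus_idem plus_idem' by blast
next
  case (wtrace_tau s s1 w v)
  then have ge: "s \<preceq> Plus s y" for y
    by (intro unstable_le_plus) (auto simp: initials_def)
  have "Plus s s1 \<preceq> Plus s (Pref Tau s1)" by (intro plus_mono_right le_tau)
  also have "\<dots> \<preceq> s"
    using wtrace_tau.hyps by (intro le_if_summands_eq) (auto simp: step_iff_summands)
  finally have s1: "Plus s s1 \<preceq> s" .
  have "Plus s v \<preceq> Plus (Plus s s1) v" by (intro plus_mono_left ge)
  also have "\<dots> \<preceq> Plus s (Plus s1 v)" by (rule plus_assoc)
  also have "\<dots> \<preceq> Plus s s1" using wtrace_tau by (intro plus_mono_right) simp
  also have "\<dots> \<preceq> s" by (rule s1)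
  finally show ?case using ge by blast
qed simp

lemma absorb_weak_summand:
  assumes "wtrace u [] v" "s \<in> summands v"
  shows "Plus u s \<preceq> u"
proof -
  have v: "Plus u v \<preceq> u" "u \<preceq> Plus u v" using absorb_tau_derivative assms(1) by auto
  have "Plus u s \<preceq> Plus (Plus u v) s" using v by (intro plus_mono_left)
  also have "\<dots> \<preceq> Plus u v" using summands_summand[OF assms(2)] assms(2) by (intro le_if_summands_eq) auto
  also have "\<dots> \<preceq> u" by (rule v)
  finally show ?thesis .
qed

section \<open>Merging summands with a common prefix by WIF1\<close>

definition tau_sum :: "'a trm list \<Rightarrow> 'a trm" where
  "tau_sum ds = foldr (\<lambda>d. Plus (Pref Tau d)) ds Zero"

lemma summands_tau_sum: "summands (tau_sum ds) = Pref Tau ` set ds"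
  by (induction ds) (auto simp: tau_sum_def)

text \<open>WIF1 splits the prefixed sum into the prefixes of its members, one at a time. For the
  empty list the sum is \<open>Zero\<close>, and nothing would make \<open>u\<close> absorb
  \<open>Pref \<alpha> Zero\<close>.\<close>

lemma absorb_pref_tau_sum:
  assumes "ds \<noteq> []" "\<And>d. d \<in> set ds \<Longrightarrow> Plus u (Pref \<alpha> d) \<preceq> u"
  shows "Plus u (Pref \<alpha> (tau_sum ds)) \<preceq> u"
  using assms
proof (induction ds)
  case (Cons d ds)
  show ?case
  proof (cases "ds = []")
    case True
    have "Pref \<alpha> (tau_sum [d]) \<preceq> Pref \<alpha> (Pref Tau d)"
      by (auto simp: tau_sum_def intro: derivable_pref plus_Zero)
    also have "\<dots> \<preceq> Pref \<alpha> d" by (rule pref_tau)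
    finally have "Plus u (Pref \<alpha> (tau_sum [d])) \<preceq> Plus u (Pref \<alpha> d)" by (rule plus_mono_right)
    also have "\<dots> \<preceq> u" using Cons.prems by simp
    finally show ?thesis using True by simp
  next
    case False
    have "Plus u (Pref \<alpha> d) \<preceq> u" by (rule Cons.prems) simp
    moreover have "Plus u (Pref \<alpha> (tau_sum ds)) \<preceq> u"
      by (rule Cons.IH[OF False]) (rule Cons.prems, simp)
    ultimately have "Plus u s \<preceq> u" if "s \<in> summands (Plus (Pref \<alpha> d) (Pref \<alpha> (tau_sum ds)))" for s
      using that by auto
    then have abs: "Plus u (Plus (Pref \<alpha> d) (Pref \<alpha> (tau_sum ds))) \<preceq> u"
      by (rule absorb_summands)
    have "Pref \<alpha> (tau_sum (d # ds)) \<preceq> Pref \<alpha> (Plus (Pref Tau d) (Pref Tau (tau_sum ds)))"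
      by (auto simp: tau_sum_def intro!: derivable_pref plus_mono_right le_tau)
    also have "\<dots> \<preceq> Plus (Pref \<alpha> d) (Pref \<alpha> (tau_sum ds))" by (rule unmerge)
    finally have "Plus u (Pref \<alpha> (tau_sum (d # ds)))
        \<preceq> Plus u (Plus (Pref \<alpha> d) (Pref \<alpha> (tau_sum ds)))"
      by (rule plus_mono_right)
    also note abs
    finally show ?thesis .
  qed
qed simp

text \<open>The converse direction of the merging: a copy of \<open>Pref Tau d\<close> is
  duplicated, the whole sum is put under a tau, and WIF1 splits off
  \<open>Pref \<alpha> d\<close>.\<close>

lemma pref_tau_sum_le:
  assumes "d \<in> set ds"
  shows "Pref \<alpha> (tau_sum ds) \<preceq> Plus (Pref \<alpha> (tau_sum ds)) (Pref \<alpha> d)"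
proof -
  have "tau_sum ds \<preceq> Plus (tau_sum ds) (Pref Tau d)"
    using assms by (intro le_if_summands_eq) (auto simp: summands_tau_sum)
  also have "\<dots> \<preceq> Plus (Pref Tau (tau_sum ds)) (Pref Tau d)"
    by (intro plus_mono_left le_tau)
  finally have "Pref \<alpha> (tau_sum ds) \<preceq> Pref \<alpha> (Plus (Pref Tau (tau_sum ds)) (Pref Tau d))"
    by (rule derivable_pref)
  also have "\<dots> \<preceq> Plus (Pref \<alpha> (tau_sum ds)) (Pref \<alpha> d)" by (rule unmerge)
  finally show ?thesis .
qed

end

section \<open>From transitions to derivability\<close>

definition top_vars :: "'a trm \<Rightarrow> nat set" where
  "top_vars t = {x. Var x \<in> summands t}"

lemma top_vars_simps [simp]:
  "top_vars Zero = {}"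
  "top_vars (Var x) = {x}"
  "top_vars (Pref \<alpha> t) = {}"
  "top_vars (Plus t u) = top_vars t \<union> top_vars u"
  by (auto simp: top_vars_def)

lemma summands_cases:
  assumes "s \<in> summands t"
  obtains \<alpha> t' where "s = Pref \<alpha> t'" "step t \<alpha> t'" | x where "s = Var x" "x \<in> top_vars t"
proof -
  have "(\<exists>\<alpha> t'. s = Pref \<alpha> t') \<or> (\<exists>x. s = Var x)"
    using assms by (induction t) auto
  then show ?thesis
    using assms that by (auto simp: step_iff_summands top_vars_def)
qed

text \<open>Substitution instances cannot detect the variables of a stable derivative that enables every
  action; with \<open>full\<close> set, such derivatives need not be matched, and F2 makes up for it.\<close>

definition refines :: "bool \<Rightarrow> 'a trm \<Rightarrow> 'a trm \<Rightarrow> bool" where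
  "refines full t u \<longleftrightarrow> (\<forall>w t'. wtrace t w t' \<longrightarrow>
     (\<exists>u'. wtrace u w u') \<and>
     (\<forall>x\<in>top_vars t'. \<exists>u'. wtrace u w u' \<and> x \<in> top_vars u') \<and>
     (Tau \<notin> initials t' \<and> \<not> (full \<and> range Vis \<subseteq> initials t') \<longrightarrow>
       (\<exists>u'. wtrace u w u' \<and> initials u' \<subseteq> initials t' \<and> top_vars u' \<subseteq> top_vars t')))"

text \<open>Passing to a derivative of \<open>t\<close> is sound as soon as \<open>u'\<close> covers
  the behaviour of \<open>u\<close> after \<open>v\<close>. It is applied with \<open>v\<close> a
  single action and with \<open>v\<close> empty.\<close>

lemma refines_trans_step:
  assumes "refines full t u" "\<And>w t''. wtrace t' w t'' \<Longrightarrow> wtrace t (v @ w) t''"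
    and "\<And>w u''. wtrace u (v @ w) u'' \<Longrightarrow> wtrace u' w u''"
  shows "refines full t' u'"
  using assms unfolding refines_def by meson

section \<open>Weak derivatives and their merged sum\<close>

definition weak_derivatives :: "'a trm \<Rightarrow> 'a \<Rightarrow> 'a trm set" where
  "weak_derivatives u a = {u2. \<exists>u1. wtrace u [] u1 \<and> step u1 (Vis a) u2}"

lemma wtrace_Cons_weak_derivatives:
  "wtrace u (a # w) u' \<longleftrightarrow> (\<exists>u2\<in>weak_derivatives u a. wtrace u2 w u')"
  unfolding weak_derivatives_def by (subst wtrace_Cons) blast

lemma finite_derivatives: "finite {t'. \<exists>w. wtrace t w t'}"
proof (induction "size t" arbitrary: t rule: less_induct)
  case less
  have fin: "finite {t'. \<exists>\<alpha>. step t \<alpha> t'}" by (induction t) (auto simp: ex_disj_distrib Collect_disj_eq)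
  have "{t'. \<exists>w. wtrace t w t'} \<subseteq>
      insert t (\<Union>s\<in>{t'. \<exists>\<alpha>. step t \<alpha> t'}. {t'. \<exists>w. wtrace s w t'})"
    by (subst wtrace_unfold) blast
  moreover have "finite \<dots>"
    using fin less step_size by auto
  ultimately show ?case by (rule finite_subset)
qed

lemma finite_weak_derivatives: "finite (weak_derivatives u a)"
proof (rule finite_subset[OF _ finite_derivatives[of u]])
  show "weak_derivatives u a \<subseteq> {t'. \<exists>w. wtrace u w t'}"
    using wtrace_Cons wtrace_refl by (fastforce simp: weak_derivatives_def)
qed

text \<open>The new continuation depends on the action alone, so all summands of \<open>t\<close>
  with the same action become equal.\<close>

fun replace_derivatives :: "('a act \<Rightarrow> 'a trm) \<Rightarrow> 'a trm \<Rightarrow> 'a trm" where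
  "replace_derivatives f Zero = Zero"
| "replace_derivatives f (Var x) = Var x"
| "replace_derivatives f (Pref \<alpha> t) = Pref \<alpha> (f \<alpha>)"
| "replace_derivatives f (Plus t u) = Plus (replace_derivatives f t) (replace_derivatives f u)"

lemma summands_replace_derivatives:
  "summands (replace_derivatives f t) = (\<lambda>\<alpha>. Pref \<alpha> (f \<alpha>)) ` initials t \<union> Var ` top_vars t"
  by (induction t) auto

lemma initials_replace_derivatives: "initials (replace_derivatives f t) = initials t"
  by (induction t) auto

context WF_theory
begin

lemma le_replace_derivatives:
  assumes "\<And>\<alpha> t'. step t \<alpha> t' \<Longrightarrow> t' \<preceq> f \<alpha>"
  shows "t \<preceq> replace_derivatives f t"
  using assms by (induction t) (auto intro: derivable_refl derivable_pref derivable_plus)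

definition weak_derivative_sum :: "'a trm \<Rightarrow> 'a \<Rightarrow> 'a trm" where
  "weak_derivative_sum u a = tau_sum (SOME ds. set ds = weak_derivatives u a)"

lemma weak_derivative_sum_list:
  obtains ds where "set ds = weak_derivatives u a" "weak_derivative_sum u a = tau_sum ds"
  using someI_ex[OF finite_list[OF finite_weak_derivatives[of u a]]]
  unfolding weak_derivative_sum_def by blast

lemma step_weak_derivative_sum:
  "step (weak_derivative_sum u a) Tau v \<longleftrightarrow> v \<in> weak_derivatives u a"
  by (rule weak_derivative_sum_list[of u a]) (auto simp: step_iff_summands summands_tau_sum)

lemma absorb_weak_derivative_sum:
  assumes "wtrace u [a] v"
  shows "Plus u (Pref (Vis a) (weak_derivative_sum u a)) \<preceq> u"
proof -
  obtain ds where ds: "set ds = weak_derivatives u a" "weak_derivative_sum u a = tau_sum ds"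
    by (rule weak_derivative_sum_list)
  have "ds \<noteq> []" using assms ds(1) by (auto simp: wtrace_Cons_weak_derivatives)
  moreover have "Plus u (Pref (Vis a) d) \<preceq> u" if "d \<in> set ds" for d
    using that ds(1)
    by (auto simp: weak_derivatives_def step_iff_summands intro: absorb_weak_summand)
  ultimately show ?thesis unfolding ds(2) by (rule absorb_pref_tau_sum)
qed

lemma pref_weak_derivative_sum_le:
  assumes "wtrace u [] v" "step v (Vis a) v'"
  shows "Pref (Vis a) (weak_derivative_sum u a)
    \<preceq> Plus (Pref (Vis a) (weak_derivative_sum u a)) (Pref (Vis a) v')"
proof -
  obtain ds where ds: "set ds = weak_derivatives u a" "weak_derivative_sum u a = tau_sum ds"
    by (rule weak_derivative_sum_list)
  show ?thesis
    unfolding ds(2) using assms ds(1) by (intro pref_tau_sum_le) (auto simp: weak_derivatives_def)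
qed

text \<open>After one tau-step the sum can become any weak \<open>a\<close>-derivative of
  \<open>u\<close>, so it does whatever \<open>u\<close> does after \<open>a\<close>.\<close>

lemma refines_weak_derivative_sum:
  assumes "refines full t u" "step t (Vis a) t'"
  shows "refines full t' (weak_derivative_sum u a)"
proof (rule refines_trans_step[OF assms(1), of _ "[a]"])
  show "wtrace t ([a] @ w) t''" if "wtrace t' w t''" for w t''
    using assms(2) that by (auto intro: wtrace_vis)
  show "wtrace (weak_derivative_sum u a) w u''" if tr: "wtrace u ([a] @ w) u''" for w u''
  proof -
    obtain u2 where "u2 \<in> weak_derivatives u a" "wtrace u2 w u''"
      using tr by (auto simp: wtrace_Cons_weak_derivatives)
    then show ?thesis by (auto simp: step_weak_derivative_sum intro: wtrace_tau)
  qed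
qed

lemma absorb_var:
  assumes "refines full t u" "x \<in> top_vars t"
  shows "Plus u (Var x) \<preceq> u"
proof -
  obtain u' where "wtrace u [] u'" "x \<in> top_vars u'"
    using assms wtrace_refl unfolding refines_def by meson
  then show ?thesis by (auto simp: top_vars_def intro: absorb_weak_summand)
qed

lemma refines_weak_trace:
  assumes "refines full t u" "Vis a \<in> initials t"
  obtains v where "wtrace u [a] v"
proof -
  obtain t' where "step t (Vis a) t'" using assms(2) by (auto simp: initials_def)
  then have "wtrace t [a] t'" using wtrace_refl by (rule wtrace_vis)
  then show ?thesis using assms(1) that unfolding refines_def by meson
qed

lemma unstable_weak_derivative_sum:
  assumes "wtrace u [a] v"
  shows "Tau \<in> initials (weak_derivative_sum u a)"
  using assms
  by (auto simp: initials_def step_weak_derivative_sum wtrace_Cons_weak_derivatives)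

lemma le_of_stable_match:
  assumes abs: "Plus u r \<preceq> u" and r: "r \<preceq> Plus v r" and v: "wtrace u [] v"
  shows "r \<preceq> u"
proof -
  \<comment> \<open>The last tau-step is isolated: \<open>Pref Tau v\<close> is then a summand of a
    tau-derivative of \<open>u\<close>, hence absorbed by \<open>u\<close>.\<close>
  consider "v = u" | u1 where "wtrace u [] u1" "step u1 Tau v"
  proof -
    have "v = u \<or> (\<exists>u1. wtrace u [] u1 \<and> step u1 Tau v)"
      if "wtrace u w v" "w = []" for w
      using that by (induction rule: wtrace.induct) (auto intro: wtrace.intros)
    then show ?thesis using that v by blast
  qed
  then show ?thesis
  proof cases
    case 1
    then show ?thesis using derivable_trans[OF r] abs by simp
  next
    case 2
    then have tau: "Plus u (Pref Tau v) \<preceq> u"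
      by (auto simp: step_iff_summands intro: absorb_weak_summand)
    note r
    also have "Plus v r \<preceq> Plus (Pref Tau (Plus v r)) u" by (rule le_tau_plus)
    also have "\<dots> \<preceq> Plus (Plus (Pref Tau v) r) u" by (intro plus_mono_left tau_plus)
    also have "\<dots> \<preceq> Plus (Plus u r) (Pref Tau v)" by (rule le_if_summands_eq) auto
    also have "\<dots> \<preceq> Plus u (Pref Tau v)" using abs by (rule plus_mono_left)
    also have "\<dots> \<preceq> u" by (rule tau)
    finally show ?thesis .
  qed
qed

text \<open>Only \<open>t\<close> has to shrink in the induction; \<open>u\<close> may be replaced
  by the merged sums, which can be larger. These sums are unstable, so the premise on tau holds for
  them automatically.\<close>

theorem derivable_if_refines:
  assumes "refines full t u" "Tau \<in> initials t \<Longrightarrow> Tau \<in> initials u"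
    and F2: "\<And>r y. full \<Longrightarrow> range Vis \<subseteq> initials r \<Longrightarrow> r \<preceq> Plus r y"
  shows "t \<preceq> u"
  using assms(1,2)
proof (induction "size t" arbitrary: t u rule: less_induct)
  case less
  note ref = less.prems(1)
  have le_sum: "t' \<preceq> weak_derivative_sum u a" if "step t (Vis a) t'" for a t'
  proof (rule less.hyps)
    show "size t' < size t" using that by (rule step_size)
    show "refines full t' (weak_derivative_sum u a)"
      using ref that by (rule refines_weak_derivative_sum)
    have "Vis a \<in> initials t" using that by (auto simp: initials_def)
    with ref obtain v where "wtrace u [a] v" by (rule refines_weak_trace)
    then show "Tau \<in> initials (weak_derivative_sum u a)" by (rule unstable_weak_derivative_sum)
  qed
  have absorb: "Plus u (Pref (Vis a) (weak_derivative_sum u a)) \<preceq> u" if "Vis a \<in> initials t" for a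
    using refines_weak_trace[OF ref that] absorb_weak_derivative_sum by metis
  show ?case
  proof (cases "Tau \<in> initials t")
    case True
    have "Plus u s \<preceq> u" if "s \<in> summands t" for s
      using that
    proof (cases rule: summands_cases)
      case (1 \<alpha> t')
      show ?thesis
      proof (cases \<alpha>)
        case (Vis a)
        have "Plus u s \<preceq> Plus u (Pref (Vis a) (weak_derivative_sum u a))"
          using 1 Vis le_sum by (auto intro: plus_mono_right derivable_pref)
        also have "\<dots> \<preceq> u" using 1 Vis by (intro absorb) (auto simp: initials_def)
        finally show ?thesis .
      next
        case Tau
        have u: "Tau \<in> initials u" using less.prems(2) True by simp
        \<comment> \<open>The tau-derivative is compared with \<open>u\<close> itself:
          \<open>u\<close> is unstable, so \<open>Pref Tau u\<close> falls back below
          \<open>u\<close>.\<close>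
        have "t' \<preceq> u"
        proof (rule less.hyps)
          show "size t' < size t" using 1 by (blast intro: step_size)
          show "refines full t' u"
            using 1 Tau by (auto intro!: refines_trans_step[OF ref, of _ "[]"] intro: wtrace_tau)
        qed (rule u)
        then have "Plus u s \<preceq> Plus u (Pref Tau u)"
          using 1 Tau by (auto intro: plus_mono_right derivable_pref)
        also have "\<dots> \<preceq> Plus u u" using u by (intro plus_mono_right tau_unstable_le)
        also have "\<dots> \<preceq> u" by (rule plus_idem)
        finally show ?thesis .
      qed
    next
      case (2 x)
      then show ?thesis using absorb_var[OF ref] by simp
    qed
    then have ut: "Plus u t \<preceq> u" by (rule absorb_summands)
    have "t \<preceq> Plus t u" using True by (rule unstable_le_plus)
    also have "\<dots> \<preceq> Plus u t" by (rule plus_comm)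
    also note ut
    finally show ?thesis .
  next
    case False
    \<comment> \<open>As \<open>t\<close> is stable, the value at \<open>Tau\<close> is a
      dummy.\<close>
    define f where "f \<alpha> = (case \<alpha> of Vis a \<Rightarrow> weak_derivative_sum u a | Tau \<Rightarrow> Zero)" for \<alpha>
    define r where "r = replace_derivatives f t"
    have "t \<preceq> r"
      unfolding r_def
    proof (rule le_replace_derivatives)
      fix \<alpha> t' assume "step t \<alpha> t'"
      with False show "t' \<preceq> f \<alpha>"
        by (cases \<alpha>) (auto simp: f_def le_sum initials_def)
    qed
    also have "r \<preceq> u"
    proof -
      have "Plus u s \<preceq> u" if s: "s \<in> summands r" for s
      proof -
        consider \<alpha> where "s = Pref \<alpha> (f \<alpha>)" "\<alpha> \<in> initials t" | x where "s = Var x" "x \<in> top_vars t"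
          using s by (auto simp: r_def summands_replace_derivatives)
        then show ?thesis
        proof cases
          case (1 \<alpha>)
          then show ?thesis using False absorb by (cases \<alpha>) (auto simp: f_def)
        next
          case (2 x)
          then show ?thesis using absorb_var[OF ref] by simp
        qed
      qed
      then have ur: "Plus u r \<preceq> u" by (rule absorb_summands)
      show ?thesis
      proof (cases "full \<and> range Vis \<subseteq> initials t")
        case True
        then have "r \<preceq> Plus r u" by (intro F2) (auto simp: r_def initials_replace_derivatives)
        also have "\<dots> \<preceq> Plus u r" by (rule plus_comm)
        also note ur
        finally show ?thesis .
      next
        case nfull: False
        then obtain v where v: "wtrace u [] v" "initials v \<subseteq> initials t" "top_vars v \<subseteq> top_vars t"
          using ref False wtrace_refl[of t] unfolding refines_def by meson
        have "r \<preceq> Plus r s" if "s \<in> summands v" for s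
          using that
        proof (cases rule: summands_cases)
          case (1 \<alpha> v')
          then have "\<alpha> \<in> initials t" using v(2) by (auto simp: initials_def)
          moreover from this obtain a where a: "\<alpha> = Vis a" using False by (cases \<alpha>) auto
          ultimately have mem: "Pref (Vis a) (weak_derivative_sum u a) \<in> summands r"
            by (force simp: r_def summands_replace_derivatives f_def)
          \<comment> \<open>The summand \<open>s\<close> is split off from the merged sum with the
            same action, which \<open>r\<close> already contains.\<close>
          let ?p = "Pref (Vis a) (weak_derivative_sum u a)"
          have "r \<preceq> Plus r ?p" using mem by (intro le_if_summands_eq) auto
          also have "\<dots> \<preceq> Plus r (Plus ?p s)"
            using 1 a v(1) pref_weak_derivative_sum_le by (intro plus_mono_right) auto
          also have "\<dots> \<preceq> Plus r s" using mem by (intro le_if_summands_eq) auto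
          finally show ?thesis .
        next
          case (2 x)
          then have "s \<in> summands r" using v(3) by (auto simp: r_def summands_replace_derivatives)
          with 2 show ?thesis by (intro le_if_summands_eq) auto
        qed
        then have "r \<preceq> Plus r v" by (rule add_summands)
        also have "\<dots> \<preceq> Plus v r" by (rule plus_comm)
        finally show ?thesis using le_of_stable_match[OF ur _ v(1)] by simp
      qed
    qed
    finally show ?thesis .
  qed
qed

end

section \<open>From substitution instances to transitions\<close>

lemma step_subst:
  "step (subst \<rho> t) \<alpha> s \<longleftrightarrow>
     (\<exists>t'. step t \<alpha> t' \<and> s = subst \<rho> t') \<or> (\<exists>x\<in>top_vars t. step (\<rho> x) \<alpha> s)"
  by (induction t) auto

lemma initials_subst: "initials (subst \<rho> t) = initials t \<union> (\<Union>x\<in>top_vars t. initials (\<rho> x))"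
  by (auto simp: initials_def step_subst)

lemma wtrace_subst: "wtrace t w t' \<Longrightarrow> wtrace (subst \<rho> t) w (subst \<rho> t')"
proof (induction rule: wtrace.induct)
  case (wtrace_tau s s1 w s')
  then have "step (subst \<rho> s) Tau (subst \<rho> s1)" by (auto simp: step_subst)
  then show ?case using wtrace_tau.IH by (rule wtrace.wtrace_tau)
next
  case (wtrace_vis s a s1 w s')
  then have "step (subst \<rho> s) (Vis a) (subst \<rho> s1)" by (auto simp: step_subst)
  then show ?case using wtrace_vis.IH by (rule wtrace.wtrace_vis)
qed (rule wtrace_refl)

text \<open>The case split is at the first step made by a substituted variable. As every
  \<open>\<rho> x\<close> is stable, that step is visible, whence \<open>w2\<close> is
  nonempty.\<close>

lemma wtrace_substE:
  assumes "wtrace (subst \<rho> t) w s" and stable: "\<And>x. Tau \<notin> initials (\<rho> x)"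
  obtains t' where "wtrace t w t'" "s = subst \<rho> t'"
  | w1 w2 t' x where "w = w1 @ w2" "w2 \<noteq> []" "wtrace t w1 t'" "x \<in> top_vars t'" "wtrace (\<rho> x) w2 s"
proof -
  have "(\<exists>t'. wtrace t w t' \<and> s = subst \<rho> t') \<or>
      (\<exists>w1 w2 t' x. w = w1 @ w2 \<and> w2 \<noteq> [] \<and> wtrace t w1 t' \<and> x \<in> top_vars t' \<and> wtrace (\<rho> x) w2 s)"
    using assms(1)
  proof (induction "subst \<rho> t" w s arbitrary: t rule: wtrace.induct)
    case wtrace_refl
    then show ?case by (blast intro: wtrace.wtrace_refl)
  next
    case (wtrace_tau s1 w s')
    then obtain t' where t': "step t Tau t'" "s1 = subst \<rho> t'"
      using stable by (auto simp: step_subst initials_def)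
    then show ?case
      using wtrace_tau.hyps(3)[OF t'(2)] by (blast intro: wtrace.wtrace_tau)
  next
    case (wtrace_vis a s1 w s')
    then consider t' where "step t (Vis a) t'" "s1 = subst \<rho> t'"
      | x where "x \<in> top_vars t" "step (\<rho> x) (Vis a) s1"
      by (auto simp: step_subst)
    then show ?case
    proof cases
      case (1 t')
      then show ?thesis
        using wtrace_vis.hyps(3)[OF 1(2)] by (metis Cons_eq_appendI wtrace.wtrace_vis)
    next
      case (2 x)
      then have "wtrace (\<rho> x) (a # w) s'" using wtrace_vis.hyps(2) by (blast intro: wtrace.wtrace_vis)
      then show ?thesis using 2 wtrace.wtrace_refl[of t]
        by (intro disjI2 exI[of _ "[]"] exI[of _ "a # w"] exI[of _ t] exI[of _ x]) simp
    qed
  qed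
  then show ?thesis using that by blast
qed

lemma wtrace_subst_var:
  assumes "wtrace t w t'" "x \<in> top_vars t'" "wtrace (\<rho> x) (a # v) s" "Tau \<notin> initials (\<rho> x)"
  shows "wtrace (subst \<rho> t) (w @ a # v) s"
proof (rule wtrace_append[OF wtrace_subst[OF assms(1)]])
  obtain s1 where "step (\<rho> x) (Vis a) s1" "wtrace s1 v s"
    using assms(3,4) by (subst (asm) wtrace_unfold) (auto simp: initials_def)
  then show "wtrace (subst \<rho> t') (a # v) s"
    using assms(2) wtrace_vis[of "subst \<rho> t'" a s1 v s] by (auto simp: step_subst)
qed

fun act_power :: "'a \<Rightarrow> nat \<Rightarrow> 'a trm" where
  "act_power b 0 = Zero"
| "act_power b (Suc n) = Pref (Vis b) (act_power b n)"

lemma vars_act_power [simp]: "vars (act_power b n) = {}"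
  by (induction n) auto

lemma initials_act_power: "initials (act_power b n) = (if n = 0 then {} else {Vis b})"
  by (cases n) auto

lemma wtrace_act_power:
  "wtrace (act_power b n) w s \<longleftrightarrow>
     length w \<le> n \<and> w = replicate (length w) b \<and> s = act_power b (n - length w)"
proof (induction n arbitrary: w)
  case 0
  then show ?case by (subst wtrace_unfold) auto
next
  case (Suc n)
  then show ?case by (subst wtrace_unfold) (cases w; auto)
qed

lemma wtrace_Zero [simp]: "wtrace Zero w s \<longleftrightarrow> w = [] \<and> s = Zero"
  by (subst wtrace_unfold) auto

lemma WF_le_weak_failure_pair:
  "WF_le t u \<Longrightarrow> closed_subst \<rho> \<Longrightarrow> weak_failure_pair (subst \<rho> t) w B
    \<Longrightarrow> weak_failure_pair (subst \<rho> u) w B"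
  by (auto simp: WF_le_def closed_WF_le_def)

lemma WF_le_trace:
  assumes "WF_le t u" "wtrace t w t'"
  shows "\<exists>u'. wtrace u w u'"
proof -
  let ?\<rho> = "\<lambda>_. Zero :: 'a trm"
  have "weak_failure_pair (subst ?\<rho> t) w {}"
    using wtrace_subst[OF assms(2)] weak_failure_pair_empty by blast
  then have "weak_failure_pair (subst ?\<rho> u) w {}"
    using WF_le_weak_failure_pair[OF assms(1), of ?\<rho>] by (simp add: closed_subst_def closed_trm_def)
  then obtain s where "wtrace (subst ?\<rho> u) w s" using weak_failure_pair_empty by blast
  then show ?thesis by (rule wtrace_substE) auto
qed

lemma WF_le_var_trace:
  fixes t u :: "'a trm"
  assumes "WF_le t u" "wtrace t w t'" "x \<in> top_vars t'"
  shows "\<exists>u'. wtrace u w u' \<and> x \<in> top_vars u'"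
proof -
  fix b :: 'a
  \<comment> \<open>The power of \<open>b\<close> exceeds what \<open>u\<close> can perform on its
    own, so the long trace must enter \<open>x\<close>. Refusing all actions forces the power to be
    used up, which fixes the point of entry as the end of \<open>w\<close>.\<close>
  define n where "n = size u"
  define \<rho> :: "nat \<Rightarrow> 'a trm" where "\<rho> y = (if y = x then act_power b (Suc n) else Zero)" for y
  have closed: "closed_subst \<rho>" by (simp add: closed_subst_def closed_trm_def \<rho>_def)
  have stable: "Tau \<notin> initials (\<rho> y)" for y by (simp add: \<rho>_def)
  have "wtrace (\<rho> x) (b # replicate n b) Zero"
    by (simp add: \<rho>_def wtrace_act_power del: act_power.simps) simp
  then have "wtrace (subst \<rho> t) (w @ b # replicate n b) Zero"
    using stable by (rule wtrace_subst_var[OF assms(2,3)])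
  then have "weak_failure_pair (subst \<rho> t) (w @ b # replicate n b) UNIV"
    by (auto simp: weak_failure_pair_wtrace)
  then have "weak_failure_pair (subst \<rho> u) (w @ b # replicate n b) UNIV"
    by (rule WF_le_weak_failure_pair[OF assms(1) closed])
  then obtain s where s: "wtrace (subst \<rho> u) (w @ b # replicate n b) s" "initials s = {}"
    by (auto simp: weak_failure_pair_wtrace)
  from s(1) stable show ?thesis
  proof (cases rule: wtrace_substE)
    case (1 u')
    then show ?thesis using wtrace_length[OF 1(1)] by (simp add: n_def)
  next
    case (2 w1 w2 u' y)
    have "y = x" using 2(2,5) by (auto simp: \<rho>_def split: if_splits)
    then have "length w2 \<le> Suc n" "s = act_power b (Suc n - length w2)"
      using 2(5) by (auto simp: \<rho>_def wtrace_act_power simp del: act_power.simps)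
    then have "length w2 = Suc n" using s(2) by (auto simp: initials_act_power split: if_splits)
    then have "w1 = w" using 2(1) by simp
    then show ?thesis using 2(3,4) \<open>y = x\<close> by blast
  qed
qed

lemma WF_le_stable_match:
  fixes t u :: "'a trm"
  assumes "WF_le t u" "wtrace t w t'" "Tau \<notin> initials t'" "Vis b \<notin> initials t'"
  shows "\<exists>u'. wtrace u w u' \<and> initials u' \<subseteq> initials t' \<and> top_vars u' \<subseteq> top_vars t'"
proof -
  define n where "n = length w"
  \<comment> \<open>Variables of \<open>t'\<close> vanish. Any other variable offers more copies of
    \<open>b\<close> than \<open>w\<close> can consume, so a match that meets one as a summand or
    has entered it still enables \<open>b\<close>, which \<open>t'\<close> refuses.\<close>
  define \<rho> :: "nat \<Rightarrow> 'a trm"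
    where "\<rho> y = (if y \<in> top_vars t' then Zero else act_power b (Suc n))" for y
  have closed: "closed_subst \<rho>" by (simp add: closed_subst_def closed_trm_def \<rho>_def)
  have stable: "Tau \<notin> initials (\<rho> y)" for y by (simp add: \<rho>_def)
  define B where "B = {a. Vis a \<notin> initials t'}"
  have B: "Vis ` (UNIV - B) = initials t'"
    using stable_initials[OF assms(3)] by (auto simp: B_def)
  have "initials (subst \<rho> t') = initials t'" by (simp add: initials_subst \<rho>_def)
  then have "weak_failure_pair (subst \<rho> t) w B"
    using wtrace_subst[OF assms(2), of \<rho>] by (auto simp: weak_failure_pair_wtrace B)
  then have "weak_failure_pair (subst \<rho> u) w B"
    by (rule WF_le_weak_failure_pair[OF assms(1) closed])
  then obtain s where s: "wtrace (subst \<rho> u) w s" "initials s \<subseteq> initials t'"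
    by (auto simp: weak_failure_pair_wtrace B)
  from s(1) stable show ?thesis
  proof (cases rule: wtrace_substE)
    case (1 u')
    have "x \<in> top_vars t'" if "x \<in> top_vars u'" for x
    proof (rule ccontr)
      assume "x \<notin> top_vars t'"
      then have "Vis b \<in> initials s" using that 1(2) by (auto simp: initials_subst \<rho>_def)
      then show False using s(2) assms(4) by blast
    qed
    moreover have "initials u' \<subseteq> initials t'" using 1(2) s(2) by (auto simp: initials_subst)
    ultimately show ?thesis using 1(1) by blast
  next
    case (2 w1 w2 u' y)
    then have "s = act_power b (Suc n - length w2)"
      by (auto simp: \<rho>_def wtrace_act_power simp del: act_power.simps split: if_splits)
    moreover have "length w2 \<le> n" using 2(1) by (simp add: n_def)
    ultimately have "Vis b \<in> initials s" by (simp add: initials_act_power)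
    then show ?thesis using s(2) assms(4) by blast
  qed
qed

lemma WF_le_refines:
  assumes "WF_le t u"
  shows "refines True t u"
  unfolding refines_def
proof (intro allI impI conjI ballI)
  fix w t' assume t': "wtrace t w t'"
  show "\<exists>u'. wtrace u w u'" using assms t' by (rule WF_le_trace)
  show "\<exists>u'. wtrace u w u' \<and> x \<in> top_vars u'" if "x \<in> top_vars t'" for x
    using assms t' that by (rule WF_le_var_trace)
  show "\<exists>u'. wtrace u w u' \<and> initials u' \<subseteq> initials t' \<and> top_vars u' \<subseteq> top_vars t'"
    if "Tau \<notin> initials t' \<and> \<not> (True \<and> range Vis \<subseteq> initials t')"
    using that WF_le_stable_match[OF assms t'] by auto
qed

lemma WF_le_Tau: "WF_le t u \<Longrightarrow> Tau \<in> initials t \<Longrightarrow> Tau \<in> initials u"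
proof -
  assume "WF_le t u" "Tau \<in> initials t"
  moreover have "closed_subst (\<lambda>_. Zero)" by (simp add: closed_subst_def closed_trm_def)
  ultimately have "Tau \<in> initials (subst (\<lambda>_. Zero) u)"
    by (auto simp: WF_le_def closed_WF_le_def initials_subst)
  then show ?thesis by (simp add: initials_subst)
qed

section \<open>Closed terms\<close>

lemma closed_step: "step t \<alpha> t' \<Longrightarrow> closed_trm t \<Longrightarrow> closed_trm t'"
  by (induction t) (auto simp: closed_trm_def)

lemma closed_wtrace: "wtrace t w t' \<Longrightarrow> closed_trm t \<Longrightarrow> closed_trm t'"
  by (induction rule: wtrace.induct) (auto dest: closed_step)

lemma closed_top_vars: "closed_trm t \<Longrightarrow> top_vars t = {}"
  by (induction t) (auto simp: closed_trm_def)

text \<open>Without variables the refusal sets alone give the match, even when every action is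
  enabled; hence \<open>full\<close> is \<open>False\<close> and ground-completeness does not call
  for F2.\<close>

lemma closed_WF_le_refines:
  assumes closed: "closed_trm t" "closed_trm u" and le: "closed_WF_le t u"
  shows "refines False t u"
proof -
  have "\<exists>u'. wtrace u w u' \<and> initials u' \<subseteq> initials t'"
    if t': "wtrace t w t'" "Tau \<notin> initials t'" for w t'
  proof -
    define B where "B = {a. Vis a \<notin> initials t'}"
    have B: "Vis ` (UNIV - B) = initials t'"
      using stable_initials[OF t'(2)] by (auto simp: B_def)
    then have "weak_failure_pair t w B" using t' by (auto simp: weak_failure_pair_wtrace)
    then have "weak_failure_pair u w B" using le by (simp add: closed_WF_le_def)
    then show ?thesis by (simp add: weak_failure_pair_wtrace B)
  qed
  moreover have "\<exists>u'. wtrace u w u'" if "wtrace t w t'" for w t'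
    using that le weak_failure_pair_empty unfolding closed_WF_le_def by blast
  moreover have "top_vars t' = {}" if "wtrace t w t'" for w t'
    using closed_wtrace[OF that closed(1)] by (rule closed_top_vars)
  moreover have "top_vars u' = {}" if "wtrace u w u'" for w u'
    using closed_wtrace[OF that closed(2)] by (rule closed_top_vars)
  ultimately show ?thesis
    unfolding refines_def by (metis empty_iff empty_subsetI)
qed

lemma F2_instance:
  assumes "WF_axioms \<subseteq> E" "(F2_lhs as xv, F2_rhs as xv y) \<in> E" "F2_choice as xv y"
    and "range Vis \<subseteq> initials r"
  shows "derivable E r (Plus r q)"
proof -
  interpret WF_theory E using assms(1) by unfold_locales
  \<comment> \<open>One derivative per action is chosen, and F2 is instantiated with these for its
    prefixed variables and with \<open>q\<close> for \<open>y\<close>. The resulting left-hand side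
    is a part of \<open>r\<close>.\<close>
  have "\<exists>p. step r (Vis a) p" for a using assms(4) by (auto simp: initials_def)
  then obtain p where p: "step r (Vis a) (p a)" for a by metis
  define \<sigma> where "\<sigma> i = (if i = y then q else p (inv xv i))" for i
  have choice: "inj xv" "y \<notin> range xv" using assms(3) by (auto simp: F2_choice_def)
  then have "\<sigma> y = q" "\<sigma> (xv a) = p a" for a by (auto simp: \<sigma>_def)
  moreover define l where "l = sum_trm (map (\<lambda>a. Pref (Vis a) (p a)) as)"
  ultimately have lq: "l \<preceq> Plus l q"
    using derivable_ax[OF assms(2), of \<sigma>] by (simp add: F2_rhs_def subst_F2_lhs)
  have "summands l \<subseteq> summands r"
  proof -
    have "summands (sum_trm ts) = (\<Union>t\<in>set ts. summands t)" for ts :: "'a trm list"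
      by (induction ts rule: sum_trm.induct) auto
    then show ?thesis using p by (auto simp: l_def step_iff_summands)
  qed
  then have sub: "summands (Plus r l) = summands r" by auto
  then have "r \<preceq> Plus r l" by (intro le_if_summands_eq) simp
  also have "\<dots> \<preceq> Plus r (Plus l q)" using lq by (rule plus_mono_right)
  also have "\<dots> \<preceq> Plus r q" using sub by (intro le_if_summands_eq) auto
  finally show ?thesis .
qed

section \<open>Completeness results\<close>

lemma omega_complete_if_WF_complete:
  assumes "sound E" "\<And>t u. WF_le t u \<Longrightarrow> derivable E t u"
  shows "omega_complete E"
  unfolding omega_complete_def
proof (intro allI impI)
  fix t u assume *: "\<forall>\<rho>. closed_subst \<rho> \<longrightarrow> derivable E (subst \<rho> t) (subst \<rho> u)"
  have "closed_WF_le (subst \<rho> t) (subst \<rho> u)" if "closed_subst \<rho>" for \<rho>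
  proof -
    \<comment> \<open>Soundness yields \<open>WF_le\<close>, a statement about all closed instances;
      a second application of \<open>\<rho>\<close> leaves the closed terms unchanged and so
      recovers the pair itself.\<close>
    have id: "subst \<rho> (subst \<rho> v) = subst \<rho> v" for v
    proof -
      have closed_id: "subst \<rho> s = s" if "closed_trm s" for s
        using that by (induction s) (auto simp: closed_trm_def)
      show ?thesis
        using \<open>closed_subst \<rho>\<close> by (simp add: subst_subst closed_id closed_subst_def)
    qed
    have "WF_le (subst \<rho> t) (subst \<rho> u)"
      using * that assms(1) by (auto simp: sound_def)
    then have "closed_WF_le (subst \<rho> (subst \<rho> t)) (subst \<rho> (subst \<rho> u))"
      using that by (simp add: WF_le_def)
    then show ?thesis by (simp only: id)
  qed
  then show "derivable E t u" by (intro assms(2)) (simp add: WF_le_def)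
qed

lemma sound_WF_axioms: "sound WF_axioms"
  by (rule sound_if_axioms_sound) (rule WF_axioms_closed_WF_le)

lemma ground_complete_WF_axioms: "ground_complete (WF_axioms :: ('a trm \<times> 'a trm) set)"
proof -
  interpret WF_theory "WF_axioms :: ('a trm \<times> 'a trm) set" by unfold_locales simp
  show ?thesis
    unfolding ground_complete_def
    by (auto intro!: derivable_if_refines[of False] closed_WF_le_refines simp: closed_WF_le_def)
qed

lemma omega_complete_infinite:
  assumes "infinite (UNIV :: 'a set)"
  shows "omega_complete (WF_axioms :: ('a trm \<times> 'a trm) set)"
proof (rule omega_complete_if_WF_complete[OF sound_WF_axioms])
  interpret WF_theory "WF_axioms :: ('a trm \<times> 'a trm) set" by unfold_locales simp
  \<comment> \<open>A term has finitely many initial actions, so the case in which F2 would be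
    called for never arises.\<close>
  have "\<not> range Vis \<subseteq> initials r" for r :: "'a trm"
  proof
    assume "range Vis \<subseteq> initials r"
    moreover have "finite (initials r)" by (induction r) auto
    ultimately show False
      using assms by (metis act.inject(1) finite_imageD finite_subset injI)
  qed
  then show "derivable WF_axioms t u" if "WF_le t u" for t u :: "'a trm"
    using derivable_if_refines[OF WF_le_refines[OF that] WF_le_Tau[OF that]] by simp
qed

lemma sound_F2:
  assumes "F2_choice as xv y"
  shows "sound (insert (F2_lhs as xv, F2_rhs as xv y) WF_axioms)"
  by (rule sound_if_axioms_sound) (use WF_axioms_closed_WF_le F2_closed_WF_le[OF assms] in auto)

lemma omega_complete_F2:
  fixes as :: "'a list"
  assumes "F2_choice as xv y"
  shows "omega_complete (insert (F2_lhs as xv, F2_rhs as xv y) WF_axioms)"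
proof (rule omega_complete_if_WF_complete[OF sound_F2[OF assms]])
  let ?E = "insert (F2_lhs as xv, F2_rhs as xv y) WF_axioms"
  interpret WF_theory ?E by unfold_locales auto
  show "derivable ?E t u" if "WF_le t u" for t u
    using WF_le_refines[OF that] WF_le_Tau[OF that]
  proof (rule derivable_if_refines)
    show "derivable ?E r (Plus r q)" if "range Vis \<subseteq> initials r" for r q
      using axioms _ assms that by (rule F2_instance) simp
  qed
qed

theorem theorem4p1:
  shows "sound (WF_axioms :: ('a :: countable trm \<times> 'a trm) set)
    \<and> ground_complete (WF_axioms :: ('a trm \<times> 'a trm) set)
    \<and> (infinite (UNIV :: 'a set) \<longrightarrow> omega_complete (WF_axioms :: ('a trm \<times> 'a trm) set))
    \<and> (finite (UNIV :: 'a set) \<longrightarrow>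
        (\<forall>(as :: 'a list) xv y. F2_choice as xv y \<longrightarrow>
           WF_le (F2_lhs as xv) (F2_rhs as xv y)
           \<and> sound (insert (F2_lhs as xv, F2_rhs as xv y) WF_axioms)
           \<and> omega_complete (insert (F2_lhs as xv, F2_rhs as xv y) WF_axioms)))"
  by (intro conjI impI allI sound_WF_axioms ground_complete_WF_axioms omega_complete_infinite
      sound_F2 omega_complete_F2)
    (simp_all add: WF_le_def F2_closed_WF_le)

end
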